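(* Let $D=\{f(a,a): a\ge 0\}$ and $S=\{p\ge 1: \text{there exists an integer } r \text{ with } 0\le r<p \text{ such that } f(p,r)=p\}$. Then every positive integer belongs to exactly one of $D$ and $S$.
   Context: Three-row Chomp. A position is a triple $[p,q,r]$ of integers with $p\ge q\ge r\ge 0$ (row lengths). The moves from $[p,q,r]$ are: reduce the first row to length $a$ with $0\le a<p$, giving $[a,\min(a,q),\min(a,r)]$; reduce the second row to length $a$ with $0\le a<q$, giving $[p,a,\min(a,r)]$; reduce the third row to length $b$ with $0\le b<r$, giving $[p,q,b]$. The player who moves to $[0,0,0]$ loses. A $P$-position is a position from which the previous player wins, and an $N$-position is one from which the next player wins. Equivalently: $[0,0,0]$ is an $N$-position, and a position other than $[0,0,0]$ is a $P$-position if and only if no move from it leads to a $P$-position. The function $f$. For all integers $q\ge r\ge 0$ there is a unique integer $p>r$ such that either (i) $r<p<q$ and $[p,p,r]$ is a $P$-position, or (ii) $p\ge q$ and $[p,q,r]$ is a $P$-position. This integer is denoted $f(q,r)$. *)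

theory Defs
  imports Main
begin

text \<open>
  A position of three-row Chomp is a triple of row lengths, first row first; the triples that
  are positions are those with \<open>p \<ge> q \<ge> r\<close>. Every move from a position leads to a position.
\<close>

definition chomp_moves :: "nat \<times> nat \<times> nat \<Rightarrow> (nat \<times> nat \<times> nat) set" where
  "chomp_moves = (\<lambda>(p, q, r).
     {(a, min a q, min a r) | a. a < p} \<union>
     {(p, a, min a r) | a. a < q} \<union>
     {(p, q, b) | b. b < r})"

text \<open>The player who moves to \<open>(0, 0, 0)\<close> loses, so that position is an N-position.\<close>

function P_position :: "nat \<times> nat \<times> nat \<Rightarrow> bool" where
  "P_position x \<longleftrightarrow> x \<noteq> (0, 0, 0) \<and> (\<forall>y\<in>chomp_moves x. \<not> P_position y)"
  by auto
termination
  by (relation "measure (\<lambda>(p, q, r). p + q + r)") (auto simp: chomp_moves_def)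

declare P_position.simps [simp del]

text \<open>Only meant for \<open>q \<ge> r\<close>, where exactly one such \<open>p\<close> exists.\<close>

definition chomp_f :: "nat \<Rightarrow> nat \<Rightarrow> nat" where
  "chomp_f q r = (THE p. p > r \<and>
     ((r < p \<and> p < q \<and> P_position (p, p, r)) \<or> (p \<ge> q \<and> P_position (p, q, r))))"

definition chomp_D :: "nat set" where
  "chomp_D = {chomp_f a a | a. a \<ge> 0}"

definition chomp_S :: "nat set" where
  "chomp_S = {p. p \<ge> 1 \<and> (\<exists>r. 0 \<le> r \<and> r < p \<and> chomp_f p r = p)}"

end

theory Submission
  imports Defs
begin

text \<open>
  Membership of \<open>n\<close> in \<open>D\<close> means that some \<open>(n, a, a)\<close> with \<open>a < n\<close> is a P-position, membership
  in \<open>S\<close> that some \<open>(n, n, r)\<close> with \<open>r < n\<close> is. At least one holds: since \<open>(a, a, a)\<close> is always an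
  N-position, \<open>(n, n, n - 1)\<close> is a P-position itself or has a move to a position of one of the two
  kinds. For disjointness, the point is that if \<open>(n, n, r)\<close> is a P-position, then each \<open>a\<close> with
  \<open>r \<le> a < n\<close> has some \<open>c < r\<close> such that \<open>(n, a, c)\<close> is a P-position. Otherwise take the
  largest exception \<open>a\<close>. The values \<open>c\<close> belonging to the \<open>n - 1 - a\<close> larger \<open>z < n\<close>, together with
  \<open>r\<close>, are \<open>n - a\<close> distinct third rows \<open>x\<close>, and for each of them \<open>(n, a, x)\<close> can only be an
  N-position because of a P-position \<open>(p, a, x)\<close> with \<open>a < p < n\<close>. These \<open>p\<close> are distinct, but
  there is room for only \<open>n - 1 - a\<close> of them.
\<close>

lemma P_position_row1:
  assumes "P_position (p, q, r)" "a < p"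
  shows "\<not> P_position (a, min a q, min a r)"
  using assms by (subst (asm) P_position.simps) (auto simp: chomp_moves_def)

lemma P_position_row2:
  assumes "P_position (p, q, r)" "a < q"
  shows "\<not> P_position (p, a, min a r)"
  using assms by (subst (asm) P_position.simps) (auto simp: chomp_moves_def)

lemma P_position_row3:
  assumes "P_position (p, q, r)" "b < r"
  shows "\<not> P_position (p, q, b)"
  using assms by (subst (asm) P_position.simps) (auto simp: chomp_moves_def)

lemma N_position_cases [consumes 2]:
  assumes "\<not> P_position (p, q, r)" "0 < p"
  obtains (row1) a where "a < p" "P_position (a, min a q, min a r)"
    | (row2) a where "a < q" "P_position (p, a, min a r)"
    | (row3) b where "b < r" "P_position (p, q, b)"
  using assms by (subst (asm) P_position.simps) (auto simp: chomp_moves_def)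

lemma not_P_position_rectangle: "\<not> P_position (a, a, a)"
proof
  assume P: "P_position (a, a, a)"
  have "a > 0"
    using P by (subst (asm) P_position.simps) auto
  have "\<not> P_position (a, a, a - 1)"
    using P_position_row3[OF P] \<open>a > 0\<close> by simp
  \<comment> \<open>Strategy stealing: every reply to \<open>(a, a, a - 1)\<close> is also a move from \<open>(a, a, a)\<close>.\<close>
  from this \<open>a > 0\<close> show False
  proof (cases rule: N_position_cases)
    case (row1 b)
    then have "min b (a - 1) = b" by simp
    then show False using P_position_row1[OF P, of b] row1 by simp
  next
    case (row2 b)
    then have "min b (a - 1) = b" by simp
    then show False using P_position_row2[OF P, of b] row2 by simp
  next
    case (row3 b)
    then show False using P_position_row3[OF P, of b] by simp
  qed
qed

text \<open>The second row \<open>min p q\<close> merges the two cases of the definition of f. Any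
  two such positions with the same \<open>q\<close> and \<open>r\<close> are then one first-row move
  apart.\<close>

definition chomp_f_rel :: "nat \<Rightarrow> nat \<Rightarrow> nat \<Rightarrow> bool" where
  "chomp_f_rel q r p \<longleftrightarrow>
     r < p \<and> P_position (p, min p q, r)"

lemma chomp_f_rel_unique:
  assumes "chomp_f_rel q r p" "chomp_f_rel q r p'"
  shows "p = p'"
proof -
  have "\<not> p1 < p2" if "chomp_f_rel q r p1" "chomp_f_rel q r p2" for p1 p2
  proof
    assume "p1 < p2"
    then have "min p1 (min p2 q) = min p1 q" by simp
    with that \<open>p1 < p2\<close> show False
      using P_position_row1[of p2 "min p2 q" r p1] by (simp add: chomp_f_rel_def)
  qed
  with assms show ?thesis by (meson linorder_neqE_nat)
qed

text \<open>Otherwise every \<open>(p, q, r)\<close> with \<open>p > q\<close> is an N-position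
  whose winning move keeps the first row, since a shorter one would give a rectangle or a witness.
  Infinitely many \<open>p\<close> then share finitely many pairs of lower rows, and a first-row
  move joins two P-positions with the same pair.\<close>

lemma chomp_f_rel_exists:
  assumes "r \<le> q"
  shows "\<exists>p. chomp_f_rel q r p"
proof (rule ccontr)
  assume none: "\<not> ?thesis"
  have "\<exists>x \<in> {..q} \<times> {..r}. P_position (p, x)" if p: "p \<in> {q<..}" for p
  proof -
    have "\<not> P_position (p, q, r)" "0 < p"
      using none p assms by (auto simp: chomp_f_rel_def dest: spec[of _ p])
    then show ?thesis
    proof (cases rule: N_position_cases)
      case (row1 a)
      consider "a \<le> r" | "r < a" by linarith
      then show ?thesis
      proof cases
        case 1
        then show ?thesis
          using row1(2) not_P_position_rectangle[of a] assms by (simp add: min_def split: if_splits)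
      next
        case 2
        then have "chomp_f_rel q r a"
          using row1(2) by (simp add: chomp_f_rel_def)
        then show ?thesis using none by blast
      qed
    next
      case (row2 a)
      then show ?thesis by (intro bexI[of _ "(a, min a r)"]) auto
    next
      case (row3 b)
      then show ?thesis by (intro bexI[of _ "(q, b)"]) auto
    qed
  qed
  then have "\<exists>g. \<forall>p\<in>{q<..}. g p \<in> {..q} \<times> {..r} \<and> P_position (p, g p)"
    by (intro bchoice) blast
  then obtain g where g: "\<And>p. q < p \<Longrightarrow> g p \<in> {..q} \<times> {..r} \<and> P_position (p, g p)"
    by auto
  have "\<not> p1 < p2" if p: "q < p1" "q < p2" "g p1 = g p2" for p1 p2
  proof
    assume "p1 < p2"
    obtain u v where "g p2 = (u, v)" "u \<le> q" "v \<le> r" "P_position (p2, u, v)"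
      using g[OF p(2)] by (cases "g p2") auto
    with P_position_row1[of p2 u v p1] g[OF p(1)] p assms \<open>p1 < p2\<close> show False
      by (simp add: min_def split: if_splits)
  qed
  then have "inj_on g {q<..}"
    by (intro linorder_inj_onI') blast
  moreover have "g ` {q<..} \<subseteq> {..q} \<times> {..r}"
    using g by blast
  ultimately have "finite {q<..}"
    by (meson finite_SigmaI finite_atMost inj_on_finite)
  then show False
    using infinite_Ioi by blast
qed

lemma chomp_f_eq_iff:
  assumes "r \<le> q"
  shows "chomp_f q r = p \<longleftrightarrow> chomp_f_rel q r p"
proof -
  have "chomp_f q r = (THE p. chomp_f_rel q r p)"
    unfolding chomp_f_def chomp_f_rel_def by (rule arg_cong[where f = The]) (auto simp: fun_eq_iff min_def le_less)
  moreover have "\<exists>!p. chomp_f_rel q r p"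
    using chomp_f_rel_exists[OF assms] chomp_f_rel_unique by blast
  ultimately show ?thesis
    by (metis theI')
qed

lemma chomp_D_iff: "n \<in> chomp_D \<longleftrightarrow> (\<exists>a<n. P_position (n, a, a))"
proof -
  have "n \<in> chomp_D \<longleftrightarrow> (\<exists>a. chomp_f a a = n)"
    by (auto simp: chomp_D_def)
  moreover have "chomp_f_rel a a n \<longleftrightarrow> a < n \<and> P_position (n, a, a)" for a
    by (auto simp: chomp_f_rel_def)
  ultimately show ?thesis
    by (simp add: chomp_f_eq_iff)
qed

lemma chomp_S_iff: "n \<in> chomp_S \<longleftrightarrow> (\<exists>r<n. P_position (n, n, r))"
  by (auto simp: chomp_S_def chomp_f_eq_iff chomp_f_rel_def)

lemma P_position_below_square:
  assumes S: "P_position (n, n, r)" and a: "r \<le> a" "a < n"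
  shows "\<exists>c<r. P_position (n, a, c)"
  using a
proof (induction "n - a" arbitrary: a rule: less_induct)
  case less
  note a = \<open>r \<le> a\<close> \<open>a < n\<close>
  show ?case
  proof (rule ccontr)
    assume no_c: "\<not> ?thesis"
    have "\<exists>c<r. P_position (n, z, c)" if "z \<in> {a<..<n}" for z
      using less.hyps[of z] that a by auto
    then obtain c where c: "\<And>z. z \<in> {a<..<n} \<Longrightarrow> c z < r \<and> P_position (n, z, c z)"
      by metis
    \<comment> \<open>As \<open>c z' < r \<le> a < z\<close>, shortening the second row from
      \<open>z'\<close> to \<open>z\<close> keeps the third row.\<close>
    have "\<not> z < z'" if "z \<in> {a<..<n}" "z' \<in> {a<..<n}" "c z = c z'" for z z'
      using P_position_row2[of n z' "c z'" z] c[OF that(1)] c[OF that(2)] that a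
      by (auto simp: min_def split: if_splits)
    then have inj_c: "inj_on c {a<..<n}"
      by (intro linorder_inj_onI') blast
    \<comment> \<open>One third row for each \<open>z\<close> with \<open>a < z \<le> n\<close>;
      \<open>r\<close> is the one for \<open>z = n\<close>.\<close>
    define C where "C = insert r (c ` {a<..<n})"
    have "r \<notin> c ` {a<..<n}"
      using c by force
    then have card_C: "card C = Suc (card {a<..<n})"
      using card_image[OF inj_c] by (simp add: C_def)
    have "\<exists>p\<in>{a<..<n}. P_position (p, a, x)" if "x \<in> C" for x
    proof -
      obtain z where z: "a < z" "z \<le> n" "P_position (n, z, x)" and "x \<le> r"
        using \<open>x \<in> C\<close> c S a by (fastforce simp: C_def)
      have "x \<le> a" using \<open>x \<le> r\<close> a by simp
      have "\<not> P_position (n, a, x)"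
        using P_position_row2[OF z(3) z(1)] \<open>x \<le> a\<close> by (simp add: min_def split: if_splits)
      moreover have "0 < n" using a by simp
      \<comment> \<open>Shortening the first row to at most \<open>a\<close>, or the second below
        \<open>a\<close>, is also a move from the P-position \<open>(n, z, x)\<close>; a shorter
        third row contradicts \<open>no_c\<close>.\<close>
      ultimately show ?thesis
      proof (cases rule: N_position_cases)
        case (row1 p)
        have "a < p"
        proof (rule ccontr)
          assume "\<not> a < p"
          then have "min p z = min p a" using z(1) by simp
          then show False using P_position_row1[OF z(3) row1(1)] row1(2) by simp
        qed
        then show ?thesis
          using row1 \<open>x \<le> a\<close> by (intro bexI[of _ p]) (auto simp: min_def split: if_splits)
      next
        case (row2 e)
        then show ?thesis
          using P_position_row2[OF z(3), of e] z(1) by simp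
      next
        case (row3 b)
        then show ?thesis
          using no_c \<open>x \<le> r\<close> by auto
      qed
    qed
    then obtain g where g: "\<And>x. x \<in> C \<Longrightarrow> g x \<in> {a<..<n} \<and> P_position (g x, a, x)"
      by metis
    have "\<not> x < x'" if "x \<in> C" "x' \<in> C" "g x = g x'" for x x'
      using P_position_row3[of "g x'" a x' x] g[OF that(1)] g[OF that(2)] that by auto
    then have "inj_on g C"
      by (intro linorder_inj_onI') blast
    moreover have "g ` C \<subseteq> {a<..<n}"
      using g by blast
    ultimately have "card C \<le> card {a<..<n}"
      by (intro card_inj_on_le) auto
    with card_C show False by simp
  qed
qed

theorem proposition4p4:
  fixes n :: nat
  assumes "n \<ge> 1"
  shows "(n \<in> chomp_D \<or> n \<in> chomp_S) \<and> \<not> (n \<in> chomp_D \<and> n \<in> chomp_S)"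
proof
  show "n \<in> chomp_D \<or> n \<in> chomp_S"
  proof (cases "P_position (n, n, n - 1)")
    case True
    moreover have "n - 1 < n" using assms by simp
    ultimately show ?thesis unfolding chomp_S_iff by blast
  next
    case False
    moreover have "0 < n" using assms by simp
    \<comment> \<open>As \<open>a \<le> n - 1\<close> for \<open>a < n\<close>, shortening the first
      row leaves a rectangle, and shortening the second leaves \<open>(n, a, a)\<close>.\<close>
    ultimately show ?thesis
    proof (cases rule: N_position_cases)
      case (row1 a)
      then have "min a n = a" "min a (n - 1) = a" by auto
      then show ?thesis using row1 not_P_position_rectangle by simp
    next
      case (row2 a)
      then have "min a (n - 1) = a" by simp
      then show ?thesis using row2 by (auto simp: chomp_D_iff)
    next
      case (row3 b)
      then have "b < n" by simp
      then show ?thesis using row3 by (auto simp: chomp_S_iff)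
    qed
  qed
  show "\<not> (n \<in> chomp_D \<and> n \<in> chomp_S)"
  proof
    assume "n \<in> chomp_D \<and> n \<in> chomp_S"
    then obtain a r where a: "a < n" "P_position (n, a, a)" and r: "P_position (n, n, r)"
      by (auto simp: chomp_D_iff chomp_S_iff)
    show False
    proof (cases "r \<le> a")
      case True
      then obtain c where "c < r" "P_position (n, a, c)"
        using P_position_below_square r a(1) by blast
      then show False using P_position_row3[OF a(2), of c] True by simp
    next
      case False
      \<comment> \<open>Here \<open>a < r\<close>, so shortening the second row of
        \<open>(n, n, r)\<close> to \<open>a\<close> cuts the third row as well and gives
        \<open>(n, a, a)\<close>.\<close>
      then show False using P_position_row2[OF r a(1)] a(2) by (simp add: min_def)
    qed
  qed
qed

end
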